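(* Let $(\mathcal{B}_1,\mathcal{B}_2,\mathcal{B}_3)$ be a tripartition of $[0,1]^n$, and let $\mathcal{I}_1=\mathcal{B}_1$, $\mathcal{I}_2=\mathcal{B}_2$, $\mathcal{I}_3=\mathcal{B}_1\cup\mathcal{B}_3$, and $\mathcal{I}_4=\mathcal{B}_2\cup\mathcal{B}_3$. Then, for any sequence $\mathcal{F}$ of $n$ conditional events, the quadruple $(s_1,s_2,s_3,s_4)$ of sentences $s_k:(\mathcal{F},\mathcal{I}_k)$, $k=1,2,3,4$, is a square of opposition.
   Context: Events are two-valued logical entities (they can be modelled as subsets of a nonempty set $\Omega$ of possible cases); an event is identified with its indicator in $\{0,1\}$. A conditional event $E|H$ is given by events $E,H$ with $H\neq\bot$ (impossible event). Given $\mathcal{F}=(E_1|H_1,\ldots,E_n|H_n)$, a precise assessment on $\mathcal{F}$ is a vector $\mathcal{P}=(p_1,\ldots,p_n)$, $p_i=p(E_i|H_i)$. It is coherent iff for every nonempty subfamily, indexed by $J\subseteq\{1,\ldots,n\}$, and all real numbers $s_j$ ($j\in J$), the random gain $\mathcal{G}=\sum_{j\in J}s_jH_j(E_j-p_j)$ satisfies $\min G\le 0\le\max G$, where $G$ is the set of values of $\mathcal{G}$ restricted to $\bigvee_{j\in J}H_j$ being true. $\Pi$ denotes the set of all coherent precise assessments on $\mathcal{F}$; it is known that $\emptyset\neq\Pi\subseteq[0,1]^n$. An imprecise assessment on $\mathcal{F}$ is any (possibly empty) subset $\mathcal{I}\subseteq[0,1]^n$; write $\pi(\mathcal{I})=\Pi\cap\mathcal{I}$.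 A sentence is a pair $s:(\mathcal{F},\mathcal{I})$. A quadruple $(s_1,s_2,s_3,s_4)$ of sentences $s_k:(\mathcal{F},\mathcal{I}_k)$ is a square of opposition (under coherence) iff: (a) $s_1,s_2$ are contraries: $\pi(\mathcal{I}_1)\cap\pi(\mathcal{I}_2)=\emptyset$; (b) $s_3,s_4$ are subcontraries: $\pi(\mathcal{I}_3)\cup\pi(\mathcal{I}_4)=\Pi$; (c) $s_1,s_4$ are contradictories: $\pi(\mathcal{I}_1)\cap\pi(\mathcal{I}_4)=\emptyset$ and $\pi(\mathcal{I}_1)\cup\pi(\mathcal{I}_4)=\Pi$; and $s_2,s_3$ are contradictories: $\pi(\mathcal{I}_2)\cap\pi(\mathcal{I}_3)=\emptyset$ and $\pi(\mathcal{I}_2)\cup\pi(\mathcal{I}_3)=\Pi$; (d) $s_3$ is a subaltern of $s_1$: $\pi(\mathcal{I}_1)\subseteq\pi(\mathcal{I}_3)$; and $s_4$ is a subaltern of $s_2$: $\pi(\mathcal{I}_2)\subseteq\pi(\mathcal{I}_4)$. A tripartition of a set $S$ is an ordered triple of (possibly empty) pairwise disjoint subsets of $S$ whose union is $S$. *)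

theory Defs
  imports "HOL-Analysis.Analysis"
begin

text \<open>
  Events are sets of possible cases of type \<open>'w\<close>; the pair \<open>(E, H)\<close> stands for \<open>E|H\<close>.
  A sequence of \<open>n\<close> conditional events is a function on a finite index type \<open>'n\<close>, so that
  assessments are vectors in \<open>real ^ 'n\<close> and \<open>n = CARD('n)\<close> is an arbitrary number \<open>\<ge> 1\<close>.
\<close>

type_synonym 'w cond_event = "'w set \<times> 'w set"

abbreviation event_of :: "'w cond_event \<Rightarrow> 'w set" where
  "event_of c \<equiv> fst c"

abbreviation hyp_of :: "'w cond_event \<Rightarrow> 'w set" where
  "hyp_of c \<equiv> snd c"

definition is_cond_event :: "'w cond_event \<Rightarrow> bool" where
  "is_cond_event c \<longleftrightarrow> hyp_of c \<noteq> {}"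

definition random_gain ::
  "('n::finite \<Rightarrow> 'w cond_event) \<Rightarrow> real ^ 'n \<Rightarrow> 'n set \<Rightarrow> ('n \<Rightarrow> real) \<Rightarrow> 'w \<Rightarrow> real" where
  "random_gain F p J s w =
     (\<Sum>j\<in>J. s j * indicator (hyp_of (F j)) w * (indicator (event_of (F j)) w - p $ j))"

definition gain_values ::
  "('n::finite \<Rightarrow> 'w cond_event) \<Rightarrow> real ^ 'n \<Rightarrow> 'n set \<Rightarrow> ('n \<Rightarrow> real) \<Rightarrow> real set" where
  "gain_values F p J s = random_gain F p J s ` (\<Union>j\<in>J. hyp_of (F j))"

text \<open>
  The set of gain values is finite and nonempty, even if \<open>'w\<close> is infinite, so its \<open>Min\<close> and
  \<open>Max\<close> are its actual minimum and maximum.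
\<close>

lemma finite_gain_values: "finite (gain_values F p J s)"
proof -
  define c where "c w = ({j. w \<in> hyp_of (F j)}, {j. w \<in> event_of (F j)})" for w
  define g where "g = (\<lambda>(A, B). \<Sum>j\<in>J. s j * indicator A j * (indicator B j - p $ j))"
  have "random_gain F p J s w = g (c w)" for w
    by (simp add: random_gain_def g_def c_def indicator_def)
  then have "gain_values F p J s \<subseteq> range g"
    by (auto simp: gain_values_def)
  then show ?thesis
    by (rule finite_subset) simp
qed

lemma gain_values_nonempty:
  assumes "\<And>i. is_cond_event (F i)" and "J \<noteq> {}"
  shows "gain_values F p J s \<noteq> {}"
  using assms by (auto simp: gain_values_def is_cond_event_def)

definition coherent :: "('n::finite \<Rightarrow> 'w cond_event) \<Rightarrow> real ^ 'n \<Rightarrow> bool" where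
  "coherent F p \<longleftrightarrow>
     (\<forall>J s. J \<noteq> {} \<longrightarrow> Min (gain_values F p J s) \<le> 0 \<and> 0 \<le> Max (gain_values F p J s))"

definition coherent_assessments :: "('n::finite \<Rightarrow> 'w cond_event) \<Rightarrow> (real ^ 'n) set" where
  "coherent_assessments F = {p. coherent F p}"

definition unit_cube :: "(real ^ 'n) set" where
  "unit_cube = {p. \<forall>i. 0 \<le> p $ i \<and> p $ i \<le> 1}"

type_synonym ('w, 'n) sentence = "('n \<Rightarrow> 'w cond_event) \<times> (real ^ 'n) set"

definition is_sentence :: "('w, 'n::finite) sentence \<Rightarrow> bool" where
  "is_sentence s \<longleftrightarrow> (\<forall>i. is_cond_event (fst s i)) \<and> snd s \<subseteq> unit_cube"

text \<open>For \<open>s = (F, I)\<close> these are the sets \<open>\<Pi>\<close> and \<open>\<pi>(I) = \<Pi> \<inter> I\<close>.\<close>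

definition Pi_of :: "('w, 'n::finite) sentence \<Rightarrow> (real ^ 'n) set" where
  "Pi_of s = coherent_assessments (fst s)"

definition pi_of :: "('w, 'n::finite) sentence \<Rightarrow> (real ^ 'n) set" where
  "pi_of s = Pi_of s \<inter> snd s"

text \<open>
  The following relations are meant for sentences over the same sequence of conditional events;
  \<open>square_of_opposition\<close> requires this explicitly.
\<close>

definition contraries :: "('w, 'n::finite) sentence \<Rightarrow> ('w, 'n) sentence \<Rightarrow> bool" where
  "contraries s t \<longleftrightarrow> pi_of s \<inter> pi_of t = {}"

definition subcontraries :: "('w, 'n::finite) sentence \<Rightarrow> ('w, 'n) sentence \<Rightarrow> bool" where
  "subcontraries s t \<longleftrightarrow> pi_of s \<union> pi_of t = Pi_of s"

definition contradictories :: "('w, 'n::finite) sentence \<Rightarrow> ('w, 'n) sentence \<Rightarrow> bool" where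
  "contradictories s t \<longleftrightarrow> pi_of s \<inter> pi_of t = {} \<and> pi_of s \<union> pi_of t = Pi_of s"

text \<open>\<open>subaltern t s\<close>: \<open>t\<close> is a subaltern of \<open>s\<close>.\<close>

definition subaltern :: "('w, 'n::finite) sentence \<Rightarrow> ('w, 'n) sentence \<Rightarrow> bool" where
  "subaltern t s \<longleftrightarrow> pi_of s \<subseteq> pi_of t"

definition square_of_opposition ::
  "('w, 'n::finite) sentence \<times> ('w, 'n) sentence \<times> ('w, 'n) sentence \<times> ('w, 'n) sentence
     \<Rightarrow> bool" where
  "square_of_opposition = (\<lambda>(s1, s2, s3, s4).
     is_sentence s1 \<and> is_sentence s2 \<and> is_sentence s3 \<and> is_sentence s4 \<and>
     fst s1 = fst s2 \<and> fst s2 = fst s3 \<and> fst s3 = fst s4 \<and>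
     contraries s1 s2 \<and>
     subcontraries s3 s4 \<and>
     contradictories s1 s4 \<and> contradictories s2 s3 \<and>
     subaltern s3 s1 \<and> subaltern s4 s2)"

definition tripartition :: "'a set \<Rightarrow> 'a set \<times> 'a set \<times> 'a set \<Rightarrow> bool" where
  "tripartition S = (\<lambda>(A, B, C).
     A \<inter> B = {} \<and> A \<inter> C = {} \<and> B \<inter> C = {} \<and> A \<union> B \<union> C = S)"

end

theory Submission
  imports Defs
begin

text \<open>
  A tripartition of the cube \<open>[0,1]\<^sup>n\<close> restricts to a tripartition of every subset of the cube.
  Applied to the set \<open>\<Pi>\<close> of coherent assessments, this makes the square of opposition a matter of
  Boolean algebra: the diagonally opposite corners \<open>\<Pi> \<inter> B1\<close> and \<open>\<Pi> \<inter> (B2 \<union> B3)\<close> are complementary in \<open>\<Pi>\<close>, and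
  likewise with \<open>B1\<close> and \<open>B2\<close> exchanged; the other relations are equally immediate.

  The one probabilistic ingredient is that \<open>\<Pi>\<close> does lie in the cube
  (\<open>coherent_assessments_subset_unit_cube\<close>): otherwise the three blocks would not exhaust \<open>\<Pi>\<close>.
  This follows by testing coherence on a unit bet on a single conditional event, which gains
  \<open>1 - p\<close> or \<open>- p\<close> whenever it is not called off: a price \<open>p < 0\<close> makes every gain positive, and a
  price \<open>p > 1\<close> makes every gain negative.
\<close>

lemma unit_bet_gains:
  "gain_values F p {i} (\<lambda>_. 1) \<subseteq> {1 - p $ i, - p $ i}"
  by (auto simp: gain_values_def random_gain_def indicator_def)

lemma coherent_imp_in_unit_cube:
  assumes coherent: "coherent F p" and cond: "\<And>i. is_cond_event (F i)"
  shows "p \<in> unit_cube"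
proof -
  have "0 \<le> p $ i \<and> p $ i \<le> 1" for i
  proof -
    let ?G = "gain_values F p {i} (\<lambda>_. 1)"
    have "?G \<noteq> {}"
      using cond by (intro gain_values_nonempty) auto
    then have "Min ?G \<in> ?G" "Max ?G \<in> ?G"
      by (simp_all add: finite_gain_values)
    then have "Min ?G \<in> {1 - p $ i, - p $ i}" "Max ?G \<in> {1 - p $ i, - p $ i}"
      using unit_bet_gains by blast+
    moreover have "Min ?G \<le> 0" "0 \<le> Max ?G"
      using coherent unfolding coherent_def by blast+
    ultimately show ?thesis by auto
  qed
  then show ?thesis by (simp add: unit_cube_def)
qed

lemma coherent_assessments_subset_unit_cube:
  assumes "\<And>i. is_cond_event (F i)"
  shows "coherent_assessments F \<subseteq> unit_cube"
  using coherent_imp_in_unit_cube[OF _ assms] by (auto simp: coherent_assessments_def)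

theorem corollary2:
  fixes B1 B2 B3 I1 I2 I3 I4 :: "(real ^ 'n::finite) set"
    and F :: "'n \<Rightarrow> 'w cond_event"
  assumes "tripartition unit_cube (B1, B2, B3)"
    and "I1 = B1" and "I2 = B2" and "I3 = B1 \<union> B3" and "I4 = B2 \<union> B3"
    and "\<And>i. is_cond_event (F i)"
  shows "square_of_opposition ((F, I1), (F, I2), (F, I3), (F, I4))"
proof -
  have disjoint: "B1 \<inter> B2 = {}" "B1 \<inter> B3 = {}" "B2 \<inter> B3 = {}"
    and cover: "B1 \<union> B2 \<union> B3 = unit_cube"
    using assms(1) by (simp_all add: tripartition_def)
  have Pi_cover: "coherent_assessments F \<subseteq> B1 \<union> B2 \<union> B3"
    using coherent_assessments_subset_unit_cube[OF assms(6)] cover by simp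
  have sentences: "is_sentence (F, I1)" "is_sentence (F, I2)" "is_sentence (F, I3)"
      "is_sentence (F, I4)"
    using cover assms(2-6) by (auto simp: is_sentence_def)
  have "contraries (F, I1) (F, I2)"
    using disjoint by (auto simp: contraries_def pi_of_def assms(2-5))
  moreover have "subcontraries (F, I3) (F, I4)"
    using Pi_cover by (auto simp: subcontraries_def pi_of_def Pi_of_def assms(2-5))
  moreover have "contradictories (F, I1) (F, I4)" "contradictories (F, I2) (F, I3)"
    using disjoint Pi_cover
    by (auto simp: contradictories_def pi_of_def Pi_of_def assms(2-5))
  moreover have "subaltern (F, I3) (F, I1)" "subaltern (F, I4) (F, I2)"
    by (auto simp: subaltern_def pi_of_def Pi_of_def assms(2-5))
  ultimately show ?thesis
    using sentences by (simp add: square_of_opposition_def)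
qed

end
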